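(* With the mesh $h>0$ fixed, $\widehat\alpha^{\,2}_N\to\alpha^{2}$ almost surely as $N\to\infty$.
   Context: Fix a mesh $h>0$, an integer $m\ge1$ and known Hurst parameters $H_1,\dots,H_m\in(1/2,1)$. Let $B^{H_1},\dots,B^{H_m}$ be independent fractional Brownian motions on one probability space, i.e. independent centred continuous Gaussian processes with $B^{H_r}(0)=0$ and $\mathbb E[B^{H_r}(t)B^{H_r}(s)]=\frac12(t^{2H_r}+s^{2H_r}-|t-s|^{2H_r})$ for $s,t\ge0$. For $\theta\in\mathbb R$ and $\alpha>0$ set $Z(t)=\theta t+\alpha\sum_{r=1}^m B^{H_r}(t)$ and $t_k=kh$. For $N\ge1$ let $\mathbf T_N=(t_1,\dots,t_N)^\top$, $\mathbf Z^{(N)}=(Z(t_1),\dots,Z(t_N))^\top$, and let $\Gamma_{H,N}$ be the $N\times N$ positive definite matrix with entries $\frac12\sum_{r=1}^m(t_i^{2H_r}+t_j^{2H_r}-|t_i-t_j|^{2H_r})$. Put $$\widehat\alpha^{\,2}_N=\frac1N\left(\mathbf Z^{(N)\top}\Gamma_{H,N}^{-1}\mathbf Z^{(N)}-\frac{(\mathbf T_N^\top\Gamma_{H,N}^{-1}\mathbf Z^{(N)})^2}{\mathbf T_N^\top\Gamma_{H,N}^{-1}\mathbf T_N}\right).$$ *)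

theory Defs
  imports
    "HOL-Probability.Probability"
    "Jordan_Normal_Form.Gauss_Jordan_Elimination"
begin

unbundle no inner_syntax
hide_const (open) Finite_Cartesian_Product.vec Finite_Cartesian_Product.mat

(* Gaussian laws may be degenerate (zero variance), as is B(0) for a fractional Brownian motion. *)
definition gaussian_rv :: "'w measure \<Rightarrow> ('w \<Rightarrow> real) \<Rightarrow> bool" where
  "gaussian_rv M X \<longleftrightarrow> X \<in> borel_measurable M \<and>
     ((\<exists>\<mu> \<sigma>. \<sigma> > 0 \<and> distributed M lborel X (\<lambda>x. ennreal (normal_density \<mu> \<sigma> x))) \<or>
      (\<exists>\<mu>. AE \<omega> in M. X \<omega> = \<mu>))"

definition gaussian_process :: "'w measure \<Rightarrow> 't set \<Rightarrow> ('t \<Rightarrow> 'w \<Rightarrow> real) \<Rightarrow> bool" where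
  "gaussian_process M T X \<longleftrightarrow>
     (\<forall>F c. finite F \<and> F \<subseteq> T \<longrightarrow> gaussian_rv M (\<lambda>\<omega>. \<Sum>t\<in>F. c t * X t \<omega>))"

(* Only the restriction of B to times t \<ge> 0 matters. The two path properties are required almost
   surely, which includes the case of processes having them on every path. *)
definition fractional_Brownian_motion ::
    "'w measure \<Rightarrow> real \<Rightarrow> (real \<Rightarrow> 'w \<Rightarrow> real) \<Rightarrow> bool" where
  "fractional_Brownian_motion M H B \<longleftrightarrow>
     gaussian_process M {0..} B \<and>
     (\<forall>t\<ge>0. (\<integral>\<omega>. B t \<omega> \<partial>M) = 0) \<and>
     (\<forall>t\<ge>0. \<forall>s\<ge>0. (\<integral>\<omega>. B t \<omega> * B s \<omega> \<partial>M) =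
        (t powr (2 * H) + s powr (2 * H) - \<bar>t - s\<bar> powr (2 * H)) / 2) \<and>
     (AE \<omega> in M. B 0 \<omega> = 0) \<and>
     (AE \<omega> in M. continuous_on {0..} (\<lambda>t. B t \<omega>))"

(* Independence of the processes as random elements of the product space of real-valued functions
   on {0..}, i.e. independence of the sigma-algebras they generate. *)
definition independent_processes ::
    "'w measure \<Rightarrow> ('i \<Rightarrow> real \<Rightarrow> 'w \<Rightarrow> real) \<Rightarrow> 'i set \<Rightarrow> bool" where
  "independent_processes M B I \<longleftrightarrow>
     prob_space.indep_vars M (\<lambda>_. PiM {0..} (\<lambda>_. borel)) (\<lambda>r \<omega>. \<lambda>t\<in>{0..}. B r t \<omega>) I"

definition mixed_fbm_with_drift ::
    "real \<Rightarrow> real \<Rightarrow> nat \<Rightarrow> (nat \<Rightarrow> real \<Rightarrow> 'w \<Rightarrow> real) \<Rightarrow> real \<Rightarrow> 'w \<Rightarrow> real" where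
  "mixed_fbm_with_drift \<theta> \<alpha> m B t \<omega> = \<theta> * t + \<alpha> * (\<Sum>r = 1..m. B r t \<omega>)"

(* Vector and matrix indices start at 0, so entry i refers to the grid point with number i + 1. *)
definition grid_point :: "real \<Rightarrow> nat \<Rightarrow> real" where
  "grid_point h k = real k * h"

definition time_vec :: "real \<Rightarrow> nat \<Rightarrow> real vec" where
  "time_vec h N = vec N (\<lambda>i. grid_point h (i + 1))"

definition obs_vec :: "real \<Rightarrow> (real \<Rightarrow> real) \<Rightarrow> nat \<Rightarrow> real vec" where
  "obs_vec h z N = vec N (\<lambda>i. z (grid_point h (i + 1)))"

definition cov_mat :: "(nat \<Rightarrow> real) \<Rightarrow> nat \<Rightarrow> real \<Rightarrow> nat \<Rightarrow> real mat" where
  "cov_mat H m h N = mat N N (\<lambda>(i, j).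
     let s = grid_point h (i + 1); t = grid_point h (j + 1)
     in (\<Sum>r = 1..m. s powr (2 * H r) + t powr (2 * H r) - \<bar>s - t\<bar> powr (2 * H r)) / 2)"

(* mat_inverse returns an option; it is Some here since cov_mat is positive definite for h > 0, m \<ge> 1
   and Hurst parameters in (1/2, 1). *)
definition alpha_sq_estimator ::
    "(nat \<Rightarrow> real) \<Rightarrow> nat \<Rightarrow> real \<Rightarrow> (real \<Rightarrow> real) \<Rightarrow> nat \<Rightarrow> real" where
  "alpha_sq_estimator H m h z N =
     (let G = the (mat_inverse (cov_mat H m h N)); T = time_vec h N; Z = obs_vec h z N
      in (Z \<bullet> (G *\<^sub>v Z) - (T \<bullet> (G *\<^sub>v Z))\<^sup>2 / (T \<bullet> (G *\<^sub>v T))) / real N)"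

end

theory Submission
  imports
    Defs
    "Jordan_Normal_Form.Determinant"
    "HOL-Computational_Algebra.Fundamental_Theorem_Algebra"
    "HOL-Library.Discrete_Functions"
    "HOL-Real_Asymp.Real_Asymp"
begin

hide_const (open) Module.smult

text \<open>
  A Gram-Schmidt orthonormalisation of the undrifted observations produces standardised,
  uncorrelated variables \<open>\<xi>\<^sub>0, \<xi>\<^sub>1, \<dots>\<close> that do not depend on \<open>N\<close>. In these coordinates the estimator is
  \<open>\<alpha>\<^sup>2 (\<Sum>\<^sub>i \<xi>\<^sub>i\<^sup>2 - (\<Sum>\<^sub>i a\<^sub>i \<xi>\<^sub>i)\<^sup>2 / \<Sum>\<^sub>i a\<^sub>i\<^sup>2) / N\<close>, where \<open>a\<close> is the transformed time vector: the drift is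
  projected out. Linear combinations of the \<open>\<xi>\<^sub>i\<close> are centred with fourth moment three times the
  squared variance. Hence the first sum has variance \<open>2 N\<close>, and Chebyshev and Borel-Cantelli along
  \<open>N = k\<^sup>2\<close>, together with monotonicity, give the limit \<open>1\<close>; the second term is the square of a
  standardised variable, and its fourth moment makes it \<open>o(N)\<close> almost surely.

  Positive definiteness of the covariance matrix, without which \<open>\<Gamma>\<^sup>-\<^sup>1\<close> would be meaningless, comes
  from the stationarity of the increments: a null vector of their Toeplitz matrix is a linear
  recurrence satisfied on all of \<open>\<int>\<close> by the autocovariance, which tends to \<open>0\<close> at both ends because
  \<open>H < 1\<close>. Splitting the characteristic polynomial into linear factors shows that only the zero
  sequence does this.
\<close>

section \<open>Bilinear forms on finitely supported sequences\<close>

text \<open>A real polynomial serves as a finitely supported coefficient vector; multiplication by the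
  indeterminate is then the index shift.\<close>

definition lin_ext :: "(nat \<Rightarrow> 'a::comm_ring_1) \<Rightarrow> 'a poly \<Rightarrow> 'a" where
  "lin_ext \<phi> p = (\<Sum>i\<le>degree p. coeff p i * \<phi> i)"

lemma lin_ext_eq_sum:
  assumes "degree p < N"
  shows "lin_ext \<phi> p = (\<Sum>i<N. coeff p i * \<phi> i)"
  unfolding lin_ext_def
  by (rule sum.mono_neutral_left) (use assms in \<open>auto simp: coeff_eq_0\<close>)

lemma lin_ext_add: "lin_ext \<phi> (p + q) = lin_ext \<phi> p + lin_ext \<phi> q"
proof -
  define N where "N = Suc (max (degree p) (degree q))"
  have "degree p < N" "degree q < N" "degree (p + q) < N"
    using degree_add_le_max[of p q] by (auto simp: N_def)
  then show ?thesis
    by (simp add: lin_ext_eq_sum[of _ N] distrib_right sum.distrib)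
qed

lemma lin_ext_smult: "lin_ext \<phi> (smult c p) = c * lin_ext \<phi> p"
proof -
  have "degree (smult c p) < Suc (degree p)"
    by (simp add: degree_smult_le le_imp_less_Suc)
  then show ?thesis
    by (simp add: lin_ext_eq_sum[of _ "Suc (degree p)"] sum_distrib_left distrib_left mult.assoc)
qed

lemma lin_ext_0 [simp]: "lin_ext \<phi> 0 = 0"
  by (simp add: lin_ext_def)

lemma lin_ext_minus: "lin_ext \<phi> (- p) = - lin_ext \<phi> p"
  using lin_ext_smult[of \<phi> "- 1" p] by simp

lemma lin_ext_diff: "lin_ext \<phi> (p - q) = lin_ext \<phi> p - lin_ext \<phi> q"
  using lin_ext_add[of \<phi> p "- q"] by (simp add: lin_ext_minus)

lemma lin_ext_sum: "lin_ext \<phi> (\<Sum>i\<in>I. f i) = (\<Sum>i\<in>I. lin_ext \<phi> (f i))"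
  by (induction I rule: infinite_finite_induct) (auto simp: lin_ext_add)

lemma lin_ext_monom: "lin_ext \<phi> (monom 1 n) = \<phi> n"
  by (simp add: lin_ext_eq_sum[of _ "Suc n"] degree_monom_eq)

lemma lin_ext_pCons: "lin_ext \<phi> (pCons a p) = a * \<phi> 0 + lin_ext (\<lambda>i. \<phi> (Suc i)) p"
proof -
  define N where "N = Suc (degree p)"
  have "degree (pCons a p) < Suc N" "degree p < N"
    using degree_pCons_le[of a p] by (auto simp: N_def)
  then show ?thesis
    unfolding lin_ext_eq_sum[OF \<open>degree (pCons a p) < Suc N\<close>] lin_ext_eq_sum[OF \<open>degree p < N\<close>]
    by (subst sum.lessThan_Suc_shift) simp
qed

lemma lin_ext_fun_add: "lin_ext (\<lambda>i. \<phi> i + \<psi> i) p = lin_ext \<phi> p + lin_ext \<psi> p"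
  by (simp add: lin_ext_def distrib_left sum.distrib)

lemma lin_ext_fun_diff: "lin_ext (\<lambda>i. \<phi> i - \<psi> i) p = lin_ext \<phi> p - lin_ext \<psi> p"
  by (simp add: lin_ext_def right_diff_distrib sum_subtractf)

lemma lin_ext_fun_cmult: "lin_ext (\<lambda>i. c * \<phi> i) p = c * lin_ext \<phi> p"
  by (simp add: lin_ext_def sum_distrib_left mult_ac)

lemma lin_ext_fun_sum: "lin_ext (\<lambda>i. \<Sum>j\<in>J. \<phi> j i) p = (\<Sum>j\<in>J. lin_ext (\<phi> j) p)"
  by (simp add: lin_ext_def sum_distrib_left) (rule sum.swap)

lemma lin_ext_tendsto:
  fixes f :: "'b \<Rightarrow> nat \<Rightarrow> 'a :: {comm_ring_1, real_normed_algebra}"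
  assumes "\<And>i. ((\<lambda>x. f x i) \<longlongrightarrow> 0) F"
  shows "((\<lambda>x. lin_ext (f x) p) \<longlongrightarrow> 0) F"
  unfolding lin_ext_def
  by (rule tendsto_eq_rhs[OF tendsto_sum]) (auto intro!: tendsto_mult_right_zero assms)

text \<open>Unfolded, this is the form with matrix entries \<open>K i j\<close>. Nesting two copies
  of \<open>lin_ext\<close> makes linearity in each argument immediate.\<close>

definition bil :: "(nat \<Rightarrow> nat \<Rightarrow> real) \<Rightarrow> real poly \<Rightarrow> real poly \<Rightarrow> real" where
  "bil K p q = lin_ext (\<lambda>i. lin_ext (K i) q) p"

lemma bil_eq_sum:
  assumes "degree p < N" "degree q < N"
  shows "bil K p q = (\<Sum>i<N. \<Sum>j<N. coeff p i * coeff q j * K i j)"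
  using assms by (simp add: bil_def lin_ext_eq_sum[of _ N] sum_distrib_left mult_ac)

lemma bil_commute:
  assumes "\<And>i j. K i j = K j i"
  shows "bil K p q = bil K q p"
proof -
  define N where "N = Suc (max (degree p) (degree q))"
  have "degree p < N" "degree q < N" by (auto simp: N_def)
  then show ?thesis
    using assms by (subst (1 2) bil_eq_sum[of _ N], simp_all)
      (subst sum.swap, simp add: mult_ac)
qed

lemma bil_simps:
  "bil K (p - p') q = bil K p q - bil K p' q"
  "bil K (smult c p) q = c * bil K p q"
  "bil K (sum f I) q = (\<Sum>i\<in>I. bil K (f i) q)"
  "bil K p (q - q') = bil K p q - bil K p q'"
  "bil K p (smult c q) = c * bil K p q"
  "bil K p (sum g J) = (\<Sum>j\<in>J. bil K p (g j))"
  by (simp_all add: bil_def lin_ext_diff lin_ext_smult lin_ext_sum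
      lin_ext_fun_diff lin_ext_fun_cmult lin_ext_fun_sum)

lemma bil_fun_sum: "bil (\<lambda>i j. \<Sum>r\<in>I. K r i j) p q = (\<Sum>r\<in>I. bil (K r) p q)"
  by (simp add: bil_def lin_ext_fun_sum)

text \<open>Gram-Schmidt on the monomials. The degree bound makes the change of basis triangular, so
  one sequence serves every matrix size at once.\<close>

lemma orthonormal_sequence_exists:
  assumes sym: "\<And>i j. K i j = K j i"
    and pd: "\<And>p. p \<noteq> 0 \<Longrightarrow> bil K p p > 0"
  shows "\<exists>P. (\<forall>n. degree (P n) \<le> n) \<and> (\<forall>n k. bil K (P n) (P k) = of_bool (n = k))"
proof -
  \<comment> \<open>Orthogonality is demanded only against smaller indices, since the choice
    principle sees only earlier values; symmetry of \<open>K\<close> supplies the rest.\<close>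
  define Q where "Q f n r \<longleftrightarrow> degree r \<le> n \<and> bil K r r = 1 \<and> (\<forall>k<n. bil K r (f k) = 0)"
    for f :: "nat \<Rightarrow> real poly" and n r
  have "\<exists>P. \<forall>n. Q P n (P n)"
  proof (rule dependent_wellorder_choice)
    fix r and f g :: "nat \<Rightarrow> real poly" and n :: nat
    assume "\<And>k. k < n \<Longrightarrow> f k = g k"
    then show "Q f n r = Q g n r" by (simp add: Q_def)
  next
    fix n :: nat and f :: "nat \<Rightarrow> real poly"
    assume f: "\<And>k. k < n \<Longrightarrow> Q f k (f k)"
    have ortho: "bil K (f j) (f k) = of_bool (j = k)" if "j < n" "k < n" for j k
      using that f[of j] f[of k] bil_commute[of K "f j" "f k", OF sym]
      by (cases j k rule: linorder_cases) (auto simp: Q_def)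
    define v where "v = monom 1 n - (\<Sum>j<n. smult (bil K (monom 1 n) (f j)) (f j))"
    have deg: "degree (f j) < n" if "j < n" for j
      using f[OF that] that by (auto simp: Q_def)
    \<comment> \<open>The subtracted projections have degree below \<open>n\<close>, so the monomial
      survives and \<open>v\<close> can be normalised.\<close>
    then have "coeff v n = 1"
      by (simp add: v_def coeff_sum coeff_eq_0)
    then have "v \<noteq> 0" by auto
    then have pos: "bil K v v > 0" by (rule pd)
    have deg_v: "degree v \<le> n"
      unfolding v_def
      by (intro degree_diff_le degree_monom_le degree_sum_le order.trans[OF degree_smult_le])
        (auto intro: less_imp_le deg)
    have "bil K v (f k) = 0" if "k < n" for k
      using that by (simp add: v_def bil_simps ortho of_bool_def if_distrib cong: if_cong)
    moreover define r where "r = smult (1 / sqrt (bil K v v)) v"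
    ultimately have "Q f n r"
      using pos deg_v order.trans[OF degree_smult_le deg_v]
      by (simp add: Q_def bil_simps)
    then show "\<exists>r. Q f n r" ..
  qed
  then obtain P where P: "\<And>n. Q P n (P n)" by blast
  have "bil K (P n) (P k) = of_bool (n = k)" for n k
    using P[of n] P[of k] bil_commute[of K "P n" "P k", OF sym]
    by (cases n k rule: linorder_cases) (auto simp: Q_def)
  with P show ?thesis by (intro exI[of _ P]) (auto simp: Q_def)
qed

section \<open>Positive definiteness of stationary covariances\<close>

text \<open>Induction on the degree. Splitting off a root \<open>z\<close> leaves a filtered
  sequence that is geometric, and a geometric sequence on the integers that tends to zero at both
  ends is zero. Hence the cofactor of lower degree annihilates \<open>\<rho>\<close> too.\<close>

lemma linear_recurrence_vanishing_imp_zero: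
  fixes \<rho> :: "int \<Rightarrow> complex"
  assumes "p \<noteq> 0"
    and rec: "\<And>k. lin_ext (\<lambda>i. \<rho> (k - int i)) p = 0"
    and top: "(\<lambda>n. \<rho> (int n)) \<longlonglongrightarrow> 0"
    and bot: "(\<lambda>n. \<rho> (- int n)) \<longlonglongrightarrow> 0"
  shows "\<rho> k = 0"
  using assms(1,2)
proof (induction "degree p" arbitrary: p k)
  case 0
  then obtain c where "p = [:c:]" by (metis degree_eq_zeroE)
  with 0 have "c \<noteq> 0" "c * \<rho> k = 0"
    using 0(3)[of k] by (auto simp: lin_ext_def)
  then show ?case by simp
next
  case (Suc d)
  then have "\<not> constant (poly p)"
    by (metis constant_degree nat.distinct(1))
  then obtain z where "poly p z = 0" using fundamental_theorem_of_algebra by blast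
  then obtain u where p: "p = [:- z, 1:] * u"
    by (metis poly_eq_0_iff_dvd dvd_def)
  with \<open>p \<noteq> 0\<close> have "u \<noteq> 0" by auto
  then have "degree p = Suc (degree u)"
    unfolding p by (subst degree_mult_eq) auto
  with Suc(2) \<open>u \<noteq> 0\<close> have u: "u \<noteq> 0" "degree u = d" by auto
  define \<tau> where "\<tau> k = lin_ext (\<lambda>i. \<rho> (k - int i)) u" for k
  \<comment> \<open>As \<open>p\<close> is the shift of \<open>u\<close> minus \<open>z\<close>
    times \<open>u\<close>, the recurrence for \<open>p\<close> says exactly that
    \<open>\<tau>\<close> is geometric.\<close>
  have "\<tau> (k - 1) = z * \<tau> k" for k
  proof -
    have p_eq: "p = smult (- z) u + pCons 0 u" by (simp add: p)
    have "lin_ext (\<lambda>i. \<rho> (k - int i)) p = - z * \<tau> k + lin_ext (\<lambda>i. \<rho> (k - int (Suc i))) u"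
      unfolding p_eq lin_ext_add lin_ext_smult lin_ext_pCons \<tau>_def by simp
    also have "(\<lambda>i. \<rho> (k - int (Suc i))) = (\<lambda>i. \<rho> (k - 1 - int i))"
      by (simp add: algebra_simps)
    finally show ?thesis using Suc(4)[of k] by (simp add: \<tau>_def)
  qed
  then have pow: "\<tau> (k - int n) = z ^ n * \<tau> k" for k n
    by (induction n arbitrary: k) (simp_all add: algebra_simps flip: diff_diff_eq)
  have shift_top: "(\<lambda>n. \<rho> (int n + k)) \<longlonglongrightarrow> 0" for k
  \<comment> \<open>Adding \<open>\<bar>k\<bar>\<close> to \<open>n\<close> keeps the index a
    natural number, so that \<open>top\<close> applies.\<close>
  proof (rule LIMSEQ_offset[where k = "nat \<bar>k\<bar>"])
    have "(\<lambda>n. \<rho> (int (n + nat (\<bar>k\<bar> + k)))) \<longlonglongrightarrow> 0"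
      using top by (rule LIMSEQ_ignore_initial_segment)
    moreover have "int (n + nat (\<bar>k\<bar> + k)) = int (n + nat \<bar>k\<bar>) + k" for n by simp
    ultimately show "(\<lambda>n. \<rho> (int (n + nat \<bar>k\<bar>) + k)) \<longlonglongrightarrow> 0" by (simp only:)
  qed
  have shift_bot: "(\<lambda>n. \<rho> (k - int n)) \<longlonglongrightarrow> 0" for k
  proof (rule LIMSEQ_offset[where k = "nat \<bar>k\<bar>"])
    have "(\<lambda>n. \<rho> (- int (n + nat (\<bar>k\<bar> - k)))) \<longlonglongrightarrow> 0"
      using bot by (rule LIMSEQ_ignore_initial_segment)
    moreover have "- int (n + nat (\<bar>k\<bar> - k)) = k - int (n + nat \<bar>k\<bar>)" for n by simp
    ultimately show "(\<lambda>n. \<rho> (k - int (n + nat \<bar>k\<bar>))) \<longlonglongrightarrow> 0" by (simp only:)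
  qed
  have "\<tau> k = 0" for k
  proof (cases "norm z \<ge> 1")
    \<comment> \<open>Outside the open unit disc the norms do not decrease towards minus infinity,
      yet they tend to zero there.\<close>
    case True
    have "(\<lambda>n. \<tau> (k - int n)) \<longlonglongrightarrow> 0"
      unfolding \<tau>_def using shift_bot[of "k - int i" for i]
      by (intro lin_ext_tendsto) (simp add: algebra_simps)
    then have "(\<lambda>n. norm (\<tau> (k - int n))) \<longlonglongrightarrow> 0" by (rule tendsto_norm_zero)
    moreover have "norm (\<tau> k) \<le> norm (\<tau> (k - int n))" for n
      using mult_right_mono[OF one_le_power[OF True, of n], of "norm (\<tau> k)"]
      by (simp add: pow norm_mult norm_power)
    ultimately have "norm (\<tau> k) \<le> 0" by (intro LIMSEQ_le_const) auto
    then show ?thesis by simp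
  next
    \<comment> \<open>Inside the disc the same comparison runs towards plus infinity.\<close>
    case False
    have "(\<lambda>n. \<tau> (k + int n)) \<longlonglongrightarrow> 0"
      unfolding \<tau>_def using shift_top[of "k - int i" for i]
      by (intro lin_ext_tendsto) (simp add: algebra_simps)
    then have "(\<lambda>n. norm (\<tau> (k + int n))) \<longlonglongrightarrow> 0" by (rule tendsto_norm_zero)
    moreover have "norm (\<tau> k) \<le> norm (\<tau> (k + int n))" for n
      using pow[of "k + int n" n] False power_le_one[of "norm z" n]
        mult_right_mono[of "norm z ^ n" 1 "norm (\<tau> (k + int n))"]
      by (simp add: norm_mult norm_power)
    ultimately have "norm (\<tau> k) \<le> 0" by (intro LIMSEQ_le_const) auto
    then show ?thesis by simp
  qed
  then show ?case
    using Suc(1)[of u k] u by (simp add: \<tau>_def)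
qed

text \<open>Degenerate Cauchy-Schwarz: along the line \<open>q - smult s p\<close> the form is
  affine in \<open>s\<close>, so a nonzero slope would make it negative somewhere.\<close>

lemma bil_null:
  assumes sym: "\<And>i j. K i j = K j i"
    and psd: "\<And>p. bil K p p \<ge> 0"
    and null: "bil K p p = 0"
  shows "bil K p q = 0"
proof (rule ccontr)
  assume b: "bil K p q \<noteq> 0"
  \<comment> \<open>Chosen so that the form takes the value \<open>- 1\<close>.\<close>
  define s where "s = (bil K q q + 1) / (2 * bil K p q)"
  have "0 \<le> bil K (q - smult s p) (q - smult s p)" by (rule psd)
  also have "\<dots> = bil K q q - 2 * s * bil K p q"
    by (simp add: bil_simps null bil_commute[of K q p, OF sym])
  also have "\<dots> = - 1" using b by (simp add: s_def field_simps)
  finally show False by simp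
qed

text \<open>A null vector of a semidefinite form is orthogonal to every unit vector. For a Toeplitz
  form these relations are a linear recurrence for \<open>\<rho>\<close>, which forces
  \<open>\<rho>\<close> to vanish.\<close>

lemma toeplitz_pos_def:
  fixes \<rho> :: "int \<Rightarrow> real"
  assumes sym: "\<And>k. \<rho> (- k) = \<rho> k"
    and psd: "\<And>p. bil (\<lambda>i j. \<rho> (int i - int j)) p p \<ge> 0"
    and lim: "(\<lambda>n. \<rho> (int n)) \<longlonglongrightarrow> 0"
    and "\<rho> 0 \<noteq> 0" and "p \<noteq> 0"
  shows "bil (\<lambda>i j. \<rho> (int i - int j)) p p > 0"
proof (rule ccontr)
  let ?K = "\<lambda>i j. \<rho> (int i - int j)"
  assume "\<not> ?thesis"
  then have null: "bil ?K p p = 0" using psd[of p] by simp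
  have symK: "?K i j = ?K j i" for i j
    using sym[of "int i - int j"] by simp
  \<comment> \<open>Shifts of a null vector are null, which extends the recurrence to negative indices.\<close>
  have shift: "bil ?K (monom 1 m * p) (monom 1 m * p) = 0" for m
  proof (induction m)
    case (Suc m)
    have "monom 1 (Suc m) * p = pCons 0 (monom 1 m * p)"
      by (simp add: monom_Suc)
    then show ?case
      using Suc by (simp add: bil_def lin_ext_pCons)
  qed (simp add: null flip: one_pCons)
  have eq: "lin_ext (\<lambda>i. \<rho> (k - int i)) p = 0" for k
  proof -
    \<comment> \<open>Shifting \<open>p\<close> by \<open>m\<close> and testing against the
      \<open>n\<close>-th unit vector gives the recurrence at \<open>n - m\<close>, so negative
      \<open>k\<close> are reached.\<close>
    obtain m n :: nat where k: "k = int n - int m"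
      by (rule int_diff_cases[of k]) blast
    have "lin_ext (\<lambda>i. \<rho> (int i - int n)) (monom 1 m * p) = 0" for n
      using bil_null[OF symK psd shift, of m "monom 1 n"]
      by (simp add: bil_def lin_ext_monom)
    moreover have "lin_ext \<phi> (monom 1 m * p) = lin_ext (\<lambda>i. \<phi> (m + i)) p" for \<phi> :: "nat \<Rightarrow> real"
      by (induction m arbitrary: \<phi>) (simp_all add: monom_Suc lin_ext_pCons flip: one_pCons)
    ultimately have "lin_ext (\<lambda>i. \<rho> (int (m + i) - int n)) p = 0" by (simp only:)
    moreover have "\<rho> (int (m + i) - int n) = \<rho> (k - int i)" for i
      using sym[of "int (m + i) - int n"] by (simp add: k algebra_simps)
    ultimately show ?thesis by simp
  qed
  \<comment> \<open>Complex coefficients guarantee roots of the characteristic polynomial.\<close>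
  define q where "q = map_poly complex_of_real p"
  have "q \<noteq> 0" using \<open>p \<noteq> 0\<close> by (auto simp: q_def map_poly_eq_0_iff)
  have "complex_of_real (\<rho> 0) = 0"
  proof (rule linear_recurrence_vanishing_imp_zero[OF \<open>q \<noteq> 0\<close>])
    fix k
    have "lin_ext (\<lambda>i. complex_of_real (\<rho> (k - int i))) q
        = complex_of_real (lin_ext (\<lambda>i. \<rho> (k - int i)) p)"
      by (simp add: lin_ext_def q_def coeff_map_poly degree_map_poly)
    then show "lin_ext (\<lambda>i. complex_of_real (\<rho> (k - int i))) q = 0"
      by (simp add: eq)
  next
    show "(\<lambda>n. complex_of_real (\<rho> (int n))) \<longlonglongrightarrow> 0"
      using tendsto_of_real[OF lim] by simp
    then show "(\<lambda>n. complex_of_real (\<rho> (- int n))) \<longlonglongrightarrow> 0"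
      by (simp add: sym)
  qed
  with \<open>\<rho> 0 \<noteq> 0\<close> show False by simp
qed


section \<open>Stationary increments and differencing\<close>

lemma bil_increments:
  "bil K ([:- 1, 1:] * u) ([:- 1, 1:] * v) =
    bil (\<lambda>i j. K (Suc i) (Suc j) - K (Suc i) j - (K i (Suc j) - K i j)) u v"
proof -
  \<comment> \<open>Summation by parts: a factor \<open>[:- 1, 1:]\<close> moves onto the sequence
    as differencing.\<close>
  have incr: "lin_ext \<phi> ([:- 1, 1:] * w) = lin_ext (\<lambda>i. \<phi> (Suc i) - \<phi> i) w"
    for \<phi> :: "nat \<Rightarrow> real" and w
    by (simp add: lin_ext_add lin_ext_diff lin_ext_pCons lin_ext_fun_diff)
  show ?thesis
    unfolding bil_def incr by (simp only: lin_ext_fun_diff)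
qed

text \<open>Here \<open>f\<close> plays the variance at integer times and \<open>\<Gamma>\<close>
  the covariance at times 1, 2, and so on. As the process starts at zero, its values are
  combinations of increments, whose covariance is Toeplitz.\<close>

lemma stationary_increments_pos_def:
  fixes f :: "int \<Rightarrow> real"
  defines "\<Gamma> \<equiv> \<lambda>i j. (f (int (Suc i)) + f (int (Suc j)) - f (int i - int j)) / 2"
  assumes f0: "f 0 = 0" and f1: "f 1 \<noteq> 0" and even: "\<And>k. f (- k) = f k"
    and lim: "(\<lambda>n. f (int n + 1) + f (int n - 1) - 2 * f (int n)) \<longlonglongrightarrow> 0"
    and psd: "\<And>p. bil \<Gamma> p p \<ge> 0"
    and "p \<noteq> 0"
  shows "bil \<Gamma> p p > 0"
proof -
  \<comment> \<open>\<open>G\<close> adds time 0, where the covariance vanishes, so a constant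
    coefficient never contributes.\<close>
  define G where "G i j = (f (int i) + f (int j) - f (int i - int j)) / 2" for i j
  define \<rho> where "\<rho> k = (f (k + 1) + f (k - 1) - 2 * f k) / 2" for k
  have G0: "G 0 j = 0" "G j 0 = 0" for j
    using even[of "int j"] by (simp_all add: G_def f0)
  have GS: "G (Suc i) (Suc j) = \<Gamma> i j" for i j
    by (simp add: G_def \<Gamma>_def)
  have bil_G: "bil G (pCons a q) (pCons b r) = bil \<Gamma> q r" for a b q r
    by (simp add: bil_def lin_ext_pCons G0 GS) (simp add: lin_ext_def)
  have "G (Suc i) (Suc j) - G (Suc i) j - (G i (Suc j) - G i j) = \<rho> (int i - int j)" for i j
    by (simp add: G_def \<rho>_def field_simps)
  then have bil_\<rho>: "bil G ([:- 1, 1:] * u) ([:- 1, 1:] * u) = bil (\<lambda>i j. \<rho> (int i - int j)) u u" for u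
    by (simp only: bil_increments)
  \<comment> \<open>The free coefficient at time 0 is chosen to make all coefficients sum to zero,
    so that the factor \<open>[:- 1, 1:]\<close> splits off.\<close>
  have "poly (pCons (- poly p 1) p) 1 = 0" by simp
  then obtain u where u: "pCons (- poly p 1) p = [:- 1, 1:] * u"
    by (metis poly_eq_0_iff_dvd dvd_def)
  with \<open>p \<noteq> 0\<close> have "u \<noteq> 0" by auto
  have "bil (\<lambda>i j. \<rho> (int i - int j)) u u > 0"
  proof (rule toeplitz_pos_def[OF _ _ _ _ \<open>u \<noteq> 0\<close>])
    show "\<rho> (- k) = \<rho> k" for k
      using even[of "k + 1"] even[of "k - 1"] even[of k] by (simp add: \<rho>_def)
    show "bil (\<lambda>i j. \<rho> (int i - int j)) q q \<ge> 0" for q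
    proof -
      obtain a r where "[:- 1, 1:] * q = pCons a r" by (rule pCons_cases)
      then show ?thesis
        using psd[of r] bil_\<rho>[of q] bil_G[of a r a r] by metis
    qed
    show "(\<lambda>n. \<rho> (int n)) \<longlonglongrightarrow> 0"
      using tendsto_divide[OF lim tendsto_const[of 2]] by (simp add: \<rho>_def)
    \<comment> \<open>The variance \<open>\<rho> 0\<close> of one increment equals
      \<open>f 1\<close>.\<close>
    show "\<rho> 0 \<noteq> 0"
      using even[of 1] by (simp add: \<rho>_def f0 f1)
  qed
  then show ?thesis
    using bil_\<rho>[of u] bil_G[of "- poly p 1" p "- poly p 1" p] unfolding u by simp
qed

text \<open>The second difference has order \<open>n powr (a - 2)\<close>, and \<open>a < 2\<close>.
  The absolute value matters only at \<open>n = 0\<close>.\<close>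

lemma second_difference_powr_tendsto_0:
  assumes "1 < a" "a < (2::real)"
  shows "(\<lambda>n. (real n + 1) powr a + \<bar>real n - 1\<bar> powr a - 2 * real n powr a) \<longlonglongrightarrow> 0"
proof (rule Lim_transform_eventually)
  show "(\<lambda>n. (real n + 1) powr a + (real n - 1) powr a - 2 * real n powr a) \<longlonglongrightarrow> 0"
    using assms by real_asymp
  show "\<forall>\<^sub>F n in sequentially. (real n + 1) powr a + (real n - 1) powr a - 2 * real n powr a
      = (real n + 1) powr a + \<bar>real n - 1\<bar> powr a - 2 * real n powr a"
    using eventually_ge_at_top[of 1] by eventually_elim simp
qed

section \<open>Moments of Gaussian combinations\<close>

text \<open>Unlike a normal density, this property covers zero variance and passes to independent sums by a
  mere computation of moments.\<close>

definition mesokurtic :: "'w measure \<Rightarrow> ('w \<Rightarrow> real) \<Rightarrow> bool" where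
  "mesokurtic M X \<longleftrightarrow> X \<in> borel_measurable M \<and> integrable M (\<lambda>\<omega>. X \<omega> ^ 4) \<and>
     (\<integral>\<omega>. X \<omega> \<partial>M) = 0 \<and> (\<integral>\<omega>. X \<omega> ^ 4 \<partial>M) = 3 * (\<integral>\<omega>. (X \<omega>)\<^sup>2 \<partial>M)\<^sup>2"

lemma abs_power_le_one_plus_power4:
  fixes x :: real
  assumes "k \<le> 4"
  shows "\<bar>x ^ k\<bar> \<le> 1 + x ^ 4"
proof (cases "\<bar>x\<bar> \<le> 1")
  case True
  then show ?thesis
    using power_le_one[of "\<bar>x\<bar>" k] zero_le_even_power[of 4 x] by (simp add: power_abs add_increasing2)
next
  case False
  then have "\<bar>x\<bar> ^ k \<le> \<bar>x\<bar> ^ 4" using assms by (intro power_increasing) auto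
  then show ?thesis by (simp add: power_abs)
qed

lemma (in prob_space) mesokurtic_integrable_power:
  assumes "mesokurtic M X" "k \<le> 4"
  shows "integrable M (\<lambda>\<omega>. X \<omega> ^ k)"
proof (rule Bochner_Integration.integrable_bound)
  show "integrable M (\<lambda>\<omega>. 1 + X \<omega> ^ 4)"
    using assms by (auto simp: mesokurtic_def)
  show "(\<lambda>\<omega>. X \<omega> ^ k) \<in> borel_measurable M"
    using assms by (auto simp: mesokurtic_def)
  show "AE \<omega> in M. norm (X \<omega> ^ k) \<le> norm (1 + X \<omega> ^ 4)"
    using abs_power_le_one_plus_power4[OF assms(2)] by (auto intro!: AE_I2 order.trans[OF _ abs_ge_self])
qed

lemma (in prob_space) gaussian_rv_mesokurtic:
  assumes "gaussian_rv M X" "(\<integral>\<omega>. X \<omega> \<partial>M) = 0"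
  shows "mesokurtic M X"
proof -
  have X [measurable]: "X \<in> borel_measurable M" using assms by (simp add: gaussian_rv_def)
  from assms(1) consider
      (normal) \<mu> \<sigma> where "\<sigma> > 0" "distributed M lborel X (\<lambda>x. ennreal (normal_density \<mu> \<sigma> x))"
    | (const) \<mu> where "AE \<omega> in M. X \<omega> = \<mu>"
    unfolding gaussian_rv_def by blast
  then show ?thesis
  proof cases
    case normal
    note int = distributed_integral[OF normal(2)] and intble = distributed_integrable[OF normal(2)]
    have "\<mu> = 0"
      using int[of "\<lambda>x. x"] integral_normal_moment_nz_1[OF normal(1), of \<mu>] assms(2)
      by (simp add: normal(1) less_imp_le)
    have "(\<integral>\<omega>. (X \<omega>)\<^sup>2 \<partial>M) = \<sigma>\<^sup>2"
      using int[of "\<lambda>x. x ^ 2"] integral_normal_moment_even[OF normal(1), of 0 1] \<open>\<mu> = 0\<close>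
      by simp
    \<comment> \<open>The constant is \<open>fact 4 / (2 ^ 2 * fact 2) = 3\<close>.\<close>
    moreover have "(\<integral>\<omega>. X \<omega> ^ 4 \<partial>M) = 3 * (\<sigma>\<^sup>2)\<^sup>2"
      using int[of "\<lambda>x. x ^ 4"] integral_normal_moment_even[OF normal(1), of 0 2] \<open>\<mu> = 0\<close>
      by (simp add: fact_numeral power_divide field_simps)
    moreover have "integrable M (\<lambda>\<omega>. X \<omega> ^ 4)"
      using intble[of "\<lambda>x. x ^ 4"] integrable_normal_moment[OF normal(1), of 0 4] \<open>\<mu> = 0\<close>
      by simp
    ultimately show ?thesis using assms(2) by (simp add: mesokurtic_def)
  next
    case const
    have "(\<integral>\<omega>. X \<omega> \<partial>M) = (\<integral>\<omega>. \<mu> \<partial>M)"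
      using const by (intro integral_cong_AE) auto
    then have "\<mu> = 0" using assms(2) by (simp add: prob_space)
    with const have X0: "AE \<omega> in M. X \<omega> = 0" by simp
    have pow: "integrable M (\<lambda>\<omega>. X \<omega> ^ k) \<and> (\<integral>\<omega>. X \<omega> ^ k \<partial>M) = 0" if "k > 0" for k
    proof -
      have AE0: "AE \<omega> in M. X \<omega> ^ k = 0" using X0 by eventually_elim (use that in simp)
      show ?thesis
        using integrable_cong_AE[OF _ _ AE0] integral_cong_AE[OF _ _ AE0] by simp
    qed
    show ?thesis
      using pow[of 2] pow[of 4] assms(2) by (simp add: mesokurtic_def)
  qed
qed

text \<open>Mixed terms containing a first power have mean zero, and the variances \<open>s\<close>
  and \<open>t\<close> satisfy \<open>3 s^2 + 6 s t + 3 t^2 = 3 (s + t)^2\<close>.\<close>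

lemma (in prob_space) mesokurtic_add:
  assumes indep: "indep_var borel X borel Y" and X: "mesokurtic M X" and Y: "mesokurtic M Y"
  shows "mesokurtic M (\<lambda>\<omega>. X \<omega> + Y \<omega>)"
    and "(\<integral>\<omega>. (X \<omega> + Y \<omega>)\<^sup>2 \<partial>M) = (\<integral>\<omega>. (X \<omega>)\<^sup>2 \<partial>M) + (\<integral>\<omega>. (Y \<omega>)\<^sup>2 \<partial>M)"
proof -
  note ints = mesokurtic_integrable_power[OF X] mesokurtic_integrable_power[OF Y]
  have ind: "indep_var borel (\<lambda>\<omega>. X \<omega> ^ i) borel (\<lambda>\<omega>. Y \<omega> ^ j)" for i j
    using indep_var_compose[OF indep, of "\<lambda>x. x ^ i" borel "\<lambda>x. x ^ j" borel] by (simp add: comp_def)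
  have prod: "integrable M (\<lambda>\<omega>. X \<omega> ^ i * Y \<omega> ^ j)"
      "(\<integral>\<omega>. X \<omega> ^ i * Y \<omega> ^ j \<partial>M) = (\<integral>\<omega>. X \<omega> ^ i \<partial>M) * (\<integral>\<omega>. Y \<omega> ^ j \<partial>M)"
    if "i \<le> 4" "j \<le> 4" for i j
    using indep_var_integrable[OF ind] indep_var_lebesgue_integral[OF ind] ints that by auto
  have mean: "(\<integral>\<omega>. X \<omega> ^ 1 \<partial>M) = 0" "(\<integral>\<omega>. Y \<omega> ^ 1 \<partial>M) = 0"
    using X Y by (simp_all add: mesokurtic_def)
  have sq: "(X \<omega> + Y \<omega>)\<^sup>2 = X \<omega> ^ 2 + 2 * (X \<omega> ^ 1 * Y \<omega> ^ 1) + Y \<omega> ^ 2" for \<omega>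
    by (simp add: power2_eq_square algebra_simps)
  have four: "(X \<omega> + Y \<omega>) ^ 4 = X \<omega> ^ 4 + 4 * (X \<omega> ^ 3 * Y \<omega> ^ 1) + 6 * (X \<omega> ^ 2 * Y \<omega> ^ 2)
      + 4 * (X \<omega> ^ 1 * Y \<omega> ^ 3) + Y \<omega> ^ 4" for \<omega>
    by (simp add: power2_eq_square power3_eq_cube power4_eq_xxxx algebra_simps)
  show sq': "(\<integral>\<omega>. (X \<omega> + Y \<omega>)\<^sup>2 \<partial>M) = (\<integral>\<omega>. (X \<omega>)\<^sup>2 \<partial>M) + (\<integral>\<omega>. (Y \<omega>)\<^sup>2 \<partial>M)"
    unfolding sq using prod[of 1 1] ints[of 2] mean
    by (subst Bochner_Integration.integral_add Bochner_Integration.integrable_add, simp_all)+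
  have "integrable M (\<lambda>\<omega>. (X \<omega> + Y \<omega>) ^ 4)"
    unfolding four using prod[of 3 1] prod[of 2 2] prod[of 1 3] ints[of 4]
    by (intro Bochner_Integration.integrable_add integrable_mult_right) auto
  moreover have "(\<integral>\<omega>. (X \<omega> + Y \<omega>) ^ 4 \<partial>M)
      = (\<integral>\<omega>. X \<omega> ^ 4 \<partial>M) + 6 * ((\<integral>\<omega>. (X \<omega>)\<^sup>2 \<partial>M) * (\<integral>\<omega>. (Y \<omega>)\<^sup>2 \<partial>M)) + (\<integral>\<omega>. Y \<omega> ^ 4 \<partial>M)"
    unfolding four using prod[of 3 1] prod[of 2 2] prod[of 1 3] ints[of 4] mean
    by (simp add: Bochner_Integration.integral_add)
  moreover have "(\<integral>\<omega>. X \<omega> + Y \<omega> \<partial>M) = 0"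
    using ints[of 1] mean by (simp add: Bochner_Integration.integral_add)
  ultimately show "mesokurtic M (\<lambda>\<omega>. X \<omega> + Y \<omega>)"
    using X Y unfolding mesokurtic_def sq' by (auto simp: power2_eq_square algebra_simps)
qed

lemma (in prob_space) mesokurtic_sum:
  assumes "finite I" "indep_vars (\<lambda>_. borel) U I" "\<And>r. r \<in> I \<Longrightarrow> mesokurtic M (U r)"
  shows "mesokurtic M (\<lambda>\<omega>. \<Sum>r\<in>I. U r \<omega>) \<and>
    (\<integral>\<omega>. (\<Sum>r\<in>I. U r \<omega>)\<^sup>2 \<partial>M) = (\<Sum>r\<in>I. \<integral>\<omega>. (U r \<omega>)\<^sup>2 \<partial>M)"
  using assms
proof (induction I rule: finite_induct)
  case empty
  then show ?case by (simp add: mesokurtic_def)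
next
  case (insert r I)
  have IH: "mesokurtic M (\<lambda>\<omega>. \<Sum>r\<in>I. U r \<omega>)"
      "(\<integral>\<omega>. (\<Sum>r\<in>I. U r \<omega>)\<^sup>2 \<partial>M) = (\<Sum>r\<in>I. \<integral>\<omega>. (U r \<omega>)\<^sup>2 \<partial>M)"
    using insert.IH[OF indep_vars_subset[OF insert.prems(1)]] insert.prems(2) by auto
  have "indep_var borel (U r) borel (\<lambda>\<omega>. \<Sum>r\<in>I. U r \<omega>)"
    by (rule indep_vars_sum[OF insert.hyps insert.prems(1)])
  from mesokurtic_add[OF this insert.prems(2) IH(1)] IH(2) insert.hyps
  show ?case by simp
qed

section \<open>Linear functionals of fractional Brownian motions\<close>

lemma (in prob_space) fractional_Brownian_motion_lin_ext:
  fixes g :: "nat \<Rightarrow> real"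
  assumes fbm: "fractional_Brownian_motion M H B" and "inj g" and g: "\<And>i. g i \<ge> 0"
  shows "mesokurtic M (\<lambda>\<omega>. lin_ext (\<lambda>i. B (g i) \<omega>) p)"
    and "(\<integral>\<omega>. (lin_ext (\<lambda>i. B (g i) \<omega>) p)\<^sup>2 \<partial>M)
      = bil (\<lambda>i j. (g i powr (2 * H) + g j powr (2 * H) - \<bar>g i - g j\<bar> powr (2 * H)) / 2) p p"
proof -
  have gauss: "gaussian_rv M (\<lambda>\<omega>. \<Sum>t\<in>F. c t * B t \<omega>)" if "finite F" "F \<subseteq> {0..}" for F c
    using fbm that by (simp add: fractional_Brownian_motion_def gaussian_process_def)
  have mean: "(\<integral>\<omega>. B t \<omega> \<partial>M) = 0" if "t \<ge> 0" for t
    using fbm that by (simp add: fractional_Brownian_motion_def)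
  have cov: "(\<integral>\<omega>. B t \<omega> * B s \<omega> \<partial>M) = (t powr (2 * H) + s powr (2 * H) - \<bar>t - s\<bar> powr (2 * H)) / 2"
    if "t \<ge> 0" "s \<ge> 0" for s t
    using fbm that unfolding fractional_Brownian_motion_def by blast
  \<comment> \<open>A one-point time set gives the marginals, and with them the moments behind every
    integrability claim below.\<close>
  have meso: "mesokurtic M (B t)" if "t \<ge> 0" for t
    using gauss[of "{t}" "\<lambda>_. 1"] mean[OF that] that by (intro gaussian_rv_mesokurtic) auto
  have int: "integrable M (B (g i))" for i
    using mesokurtic_integrable_power[OF meso[OF g], of 1 i] by simp
  have [measurable]: "B (g i) \<in> borel_measurable M" for i
    using meso[OF g, of i] by (simp add: mesokurtic_def)
  have int2: "integrable M (\<lambda>\<omega>. B (g i) \<omega> * B (g j) \<omega>)" for i j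
  proof (rule Bochner_Integration.integrable_bound)
    show "integrable M (\<lambda>\<omega>. (B (g i) \<omega>)\<^sup>2 + (B (g j) \<omega>)\<^sup>2)"
      using mesokurtic_integrable_power[OF meso[OF g], of 2] by auto
    have "\<bar>x * y\<bar> \<le> x\<^sup>2 + y\<^sup>2" for x y :: real
      using sum_squares_bound[of "\<bar>x\<bar>" "\<bar>y\<bar>"] mult_nonneg_nonneg[of "\<bar>x\<bar>" "\<bar>y\<bar>"]
      by (simp add: abs_mult mult.assoc del: mult_nonneg_nonneg)
    then show "AE \<omega> in M. norm (B (g i) \<omega> * B (g j) \<omega>) \<le> norm ((B (g i) \<omega>)\<^sup>2 + (B (g j) \<omega>)\<^sup>2)"
      by (auto intro!: AE_I2 order.trans[OF _ abs_ge_self])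
  qed simp
  \<comment> \<open>Gaussianity is phrased with coefficients attached to times. Injectivity of
    \<open>g\<close> keeps two indices from sharing a time, so the coefficients can be carried
    over.\<close>
  define F where "F = g ` {..degree p}"
  have "lin_ext (\<lambda>i. B (g i) \<omega>) p = (\<Sum>t\<in>F. coeff p (inv_into UNIV g t) * B t \<omega>)" for \<omega>
    unfolding F_def lin_ext_def
    by (subst sum.reindex[OF inj_on_subset[OF \<open>inj g\<close>]]) (simp_all add: \<open>inj g\<close>)
  moreover have "gaussian_rv M (\<lambda>\<omega>. \<Sum>t\<in>F. coeff p (inv_into UNIV g t) * B t \<omega>)"
    by (rule gauss) (auto simp: F_def g)
  ultimately have "gaussian_rv M (\<lambda>\<omega>. lin_ext (\<lambda>i. B (g i) \<omega>) p)" by simp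
  moreover have "(\<integral>\<omega>. lin_ext (\<lambda>i. B (g i) \<omega>) p \<partial>M) = 0"
    unfolding lin_ext_def using int g by (simp add: Bochner_Integration.integral_sum mean)
  ultimately show "mesokurtic M (\<lambda>\<omega>. lin_ext (\<lambda>i. B (g i) \<omega>) p)"
    by (rule gaussian_rv_mesokurtic)
  have "(\<integral>\<omega>. (lin_ext (\<lambda>i. B (g i) \<omega>) p)\<^sup>2 \<partial>M)
      = (\<integral>\<omega>. (\<Sum>i\<le>degree p. \<Sum>j\<le>degree p. coeff p i * coeff p j * (B (g i) \<omega> * B (g j) \<omega>)) \<partial>M)"
    by (simp add: lin_ext_def power2_eq_square sum_product mult_ac)
  also have "\<dots> = (\<Sum>i\<le>degree p. \<Sum>j\<le>degree p. coeff p i * coeff p j * (\<integral>\<omega>. B (g i) \<omega> * B (g j) \<omega> \<partial>M))"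
    using int2 by (simp add: Bochner_Integration.integral_sum)
  also have "\<dots> = bil (\<lambda>i j. \<integral>\<omega>. B (g i) \<omega> * B (g j) \<omega> \<partial>M) p p"
    using bil_eq_sum[of p "Suc (degree p)" p] by (simp only: lessThan_Suc_atMost lessI)
  also have "(\<lambda>i j. \<integral>\<omega>. B (g i) \<omega> * B (g j) \<omega> \<partial>M)
      = (\<lambda>i j. (g i powr (2 * H) + g j powr (2 * H) - \<bar>g i - g j\<bar> powr (2 * H)) / 2)"
    by (intro ext cov g)
  finally show "(\<integral>\<omega>. (lin_ext (\<lambda>i. B (g i) \<omega>) p)\<^sup>2 \<partial>M)
      = bil (\<lambda>i j. (g i powr (2 * H) + g j powr (2 * H) - \<bar>g i - g j\<bar> powr (2 * H)) / 2) p p" .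
qed

text \<open>Each process enters through the measurable path functional \<open>\<Phi>\<close>, so
  independence of the processes makes the contributions independent. Their variances, and therefore
  the forms, add.\<close>

lemma (in prob_space) mixed_fractional_Brownian_motion_lin_ext:
  fixes g :: "nat \<Rightarrow> real" and H :: "nat \<Rightarrow> real"
  assumes "\<And>r. r \<in> I \<Longrightarrow> fractional_Brownian_motion M (H r) (B r)"
    and indep: "independent_processes M B I" and "finite I"
    and g: "inj g" "\<And>i. g i \<ge> 0"
  shows "mesokurtic M (\<lambda>\<omega>. lin_ext (\<lambda>i. \<Sum>r\<in>I. B r (g i) \<omega>) p) \<and>
    (\<integral>\<omega>. (lin_ext (\<lambda>i. \<Sum>r\<in>I. B r (g i) \<omega>) p)\<^sup>2 \<partial>M)
      = bil (\<lambda>i j. \<Sum>r\<in>I. (g i powr (2 * H r) + g j powr (2 * H r) - \<bar>g i - g j\<bar> powr (2 * H r)) / 2) p p"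
proof -
  define \<Phi> where "\<Phi> f = lin_ext (\<lambda>i. f (g i)) p" for f :: "real \<Rightarrow> real"
  have [measurable]: "\<Phi> \<in> borel_measurable (PiM {0..} (\<lambda>_. borel))"
    unfolding \<Phi>_def[abs_def] lin_ext_def
    by (intro borel_measurable_sum borel_measurable_times borel_measurable_const
        measurable_component_singleton) (simp add: g)
  have "indep_vars (\<lambda>_. borel) (\<lambda>r \<omega>. \<Phi> (\<lambda>t\<in>{0..}. B r t \<omega>)) I"
    using indep unfolding independent_processes_def by (rule indep_vars_compose2) simp
  then have "indep_vars (\<lambda>_. borel) (\<lambda>r \<omega>. lin_ext (\<lambda>i. B r (g i) \<omega>) p) I"
    by (simp add: \<Phi>_def g)
  from mesokurtic_sum[OF \<open>finite I\<close> this] show ?thesis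
    using fractional_Brownian_motion_lin_ext[OF assms(1) g]
    by (simp add: lin_ext_fun_sum bil_fun_sum)
qed

section \<open>Almost sure limits\<close>

text \<open>Replaces Chebyshev and Borel-Cantelli in one stroke: the series of the
  \<open>f n\<close> has finite integral, so it converges almost everywhere and its terms tend to
  zero.\<close>

lemma AE_tendsto_0_if_summable_integral:
  fixes f :: "nat \<Rightarrow> 'w \<Rightarrow> real"
  assumes int: "\<And>n. integrable M (f n)" and nn: "\<And>n \<omega>. f n \<omega> \<ge> 0"
    and sm: "summable (\<lambda>n. \<integral>\<omega>. f n \<omega> \<partial>M)"
  shows "AE \<omega> in M. (\<lambda>n. f n \<omega>) \<longlonglongrightarrow> 0"
proof -
  have [measurable]: "f n \<in> borel_measurable M" for n
    using int[of n] by auto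
  have "(\<integral>\<^sup>+\<omega>. (\<Sum>n. ennreal (f n \<omega>)) \<partial>M) = (\<Sum>n. \<integral>\<^sup>+\<omega>. ennreal (f n \<omega>) \<partial>M)"
    by (rule nn_integral_suminf) simp
  also have "\<dots> = (\<Sum>n. ennreal (\<integral>\<omega>. f n \<omega> \<partial>M))"
    using int nn by (simp add: nn_integral_eq_integral)
  also have "\<dots> \<noteq> \<infinity>"
    using sm nn by (simp add: suminf_ennreal2 Bochner_Integration.integral_nonneg)
  finally have "AE \<omega> in M. (\<Sum>n. ennreal (f n \<omega>)) \<noteq> \<infinity>"
    by (intro nn_integral_noteq_infinite) auto
  then show ?thesis
    by eventually_elim (auto intro!: summable_LIMSEQ_zero summable_suminf_not_top nn)
qed

text \<open>Each \<open>n\<close> lies between consecutive squares. Monotonicity bounds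
  \<open>S n\<close> by its values there, and the ratio of these squares tends to 1.\<close>

lemma tendsto_average_if_along_squares:
  fixes S :: "nat \<Rightarrow> real"
  assumes "mono S" and S0: "\<And>n. S n \<ge> 0"
    and sq: "(\<lambda>k. S (k\<^sup>2) / real (k\<^sup>2)) \<longlonglongrightarrow> L"
  shows "(\<lambda>n. S n / real n) \<longlonglongrightarrow> L"
proof (rule tendsto_sandwich)
  define q where "q = floor_sqrt"
  have q: "filterlim q at_top sequentially"
    unfolding filterlim_at_top
  proof
    fix k
    show "\<forall>\<^sub>F n in sequentially. k \<le> q n"
      using eventually_ge_at_top[of "k\<^sup>2"] by eventually_elim (simp add: q_def le_floor_sqrt_iff)
  qed
  have q_le: "(q n)\<^sup>2 \<le> n" and q_gt: "n < (Suc (q n))\<^sup>2" for n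
    by (simp_all add: q_def Suc_floor_sqrt_power2_gt)
  have r1: "(\<lambda>k. (real k)\<^sup>2 / (real (Suc k))\<^sup>2) \<longlonglongrightarrow> 1" by real_asymp
  have r2: "(\<lambda>k. (real (Suc k))\<^sup>2 / (real k)\<^sup>2) \<longlonglongrightarrow> 1" by real_asymp
  have "(\<lambda>k. S (k\<^sup>2) / real (k\<^sup>2) * ((real k)\<^sup>2 / (real (Suc k))\<^sup>2)) \<longlonglongrightarrow> L * 1"
    by (rule tendsto_mult[OF sq r1])
  from filterlim_compose[OF this q]
  show "(\<lambda>n. S ((q n)\<^sup>2) / real ((q n)\<^sup>2) * ((real (q n))\<^sup>2 / (real (Suc (q n)))\<^sup>2)) \<longlonglongrightarrow> L"
    by simp
  have "(\<lambda>k. S ((Suc k)\<^sup>2) / real ((Suc k)\<^sup>2) * ((real (Suc k))\<^sup>2 / (real k)\<^sup>2)) \<longlonglongrightarrow> L * 1"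
    by (rule tendsto_mult[OF LIMSEQ_Suc[OF sq] r2])
  from filterlim_compose[OF this q]
  show "(\<lambda>n. S ((Suc (q n))\<^sup>2) / real ((Suc (q n))\<^sup>2) * ((real (Suc (q n)))\<^sup>2 / (real (q n))\<^sup>2)) \<longlonglongrightarrow> L"
    by simp
  have pos: "\<forall>\<^sub>F n in sequentially. n \<ge> 1 \<and> q n \<ge> 1"
    using eventually_ge_at_top[of 1] by eventually_elim (simp add: q_def le_floor_sqrt_iff)
  show "\<forall>\<^sub>F n in sequentially.
      S ((q n)\<^sup>2) / real ((q n)\<^sup>2) * ((real (q n))\<^sup>2 / (real (Suc (q n)))\<^sup>2) \<le> S n / real n"
    using pos
  proof eventually_elim
    case (elim n)
    have "S ((q n)\<^sup>2) / real ((Suc (q n))\<^sup>2) \<le> S n / real n"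
      using elim q_gt[of n] monoD[OF \<open>mono S\<close> q_le[of n]] S0
      by (intro frac_le) (auto simp del: of_nat_power of_nat_Suc)
    then show ?case using elim by simp
  qed
  show "\<forall>\<^sub>F n in sequentially.
      S n / real n \<le> S ((Suc (q n))\<^sup>2) / real ((Suc (q n))\<^sup>2) * ((real (Suc (q n)))\<^sup>2 / (real (q n))\<^sup>2)"
    using pos
  proof eventually_elim
    case (elim n)
    have "S n / real n \<le> S ((Suc (q n))\<^sup>2) / real ((q n)\<^sup>2)"
      using elim q_le[of n] monoD[OF \<open>mono S\<close> less_imp_le[OF q_gt[of n]]] S0
      by (intro frac_le) (auto simp del: of_nat_power of_nat_Suc)
    then show ?case using elim by (simp del: of_nat_Suc)
  qed
qed

text \<open>Fourth moments of two-term combinations determine the covariances of the squares, which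
  gives the variance of their sum.\<close>

lemma (in prob_space) AE_mean_squares_tendsto_1:
  fixes \<xi> :: "nat \<Rightarrow> 'a \<Rightarrow> real"
  assumes meso: "\<And>N c. mesokurtic M (\<lambda>\<omega>. \<Sum>i<N. c i * \<xi> i \<omega>)"
    and var: "\<And>(N::nat) c. (\<integral>\<omega>. (\<Sum>i<N. c i * \<xi> i \<omega>)\<^sup>2 \<partial>M) = (\<Sum>i<N. (c i)\<^sup>2)"
  shows "AE \<omega> in M. (\<lambda>N. (\<Sum>i<N. (\<xi> i \<omega>)\<^sup>2) / real N) \<longlonglongrightarrow> 1"
proof -
  define S where "S N \<omega> = (\<Sum>i<N. (\<xi> i \<omega>)\<^sup>2)" for N \<omega>
  have four: "integrable M (\<lambda>\<omega>. (a * \<xi> i \<omega> + b * \<xi> j \<omega>) ^ 4)"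
      "(\<integral>\<omega>. (a * \<xi> i \<omega> + b * \<xi> j \<omega>) ^ 4 \<partial>M) = 3 * (a\<^sup>2 + b\<^sup>2)\<^sup>2" if "i \<noteq> j" for a b i j
  proof -
    \<comment> \<open>Coefficients supported on \<open>{i, j}\<close> specialise the hypotheses to
      two variables.\<close>
    define c where "c = (\<lambda>k. if k = i then a else if k = j then b else 0)"
    define N where "N = Suc (max i j)"
    have red: "(\<Sum>k<N. f (c k) k) = f a i + f b j" if "\<And>k. f 0 k = 0" for f :: "real \<Rightarrow> nat \<Rightarrow> real"
    proof -
      have "(\<Sum>k<N. f (c k) k) = (\<Sum>k\<in>{i, j}. f (c k) k)"
        by (rule sum.mono_neutral_right) (auto simp: N_def c_def that)
      then show ?thesis using \<open>i \<noteq> j\<close> by (simp add: c_def)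
    qed
    have "(\<Sum>k<N. c k * \<xi> k \<omega>) = a * \<xi> i \<omega> + b * \<xi> j \<omega>" for \<omega>
      using red[of "\<lambda>x k. x * \<xi> k \<omega>"] by simp
    moreover have "(\<Sum>k<N. (c k)\<^sup>2) = a\<^sup>2 + b\<^sup>2"
      using red[of "\<lambda>x k. x\<^sup>2"] by simp
    ultimately show "integrable M (\<lambda>\<omega>. (a * \<xi> i \<omega> + b * \<xi> j \<omega>) ^ 4)"
      "(\<integral>\<omega>. (a * \<xi> i \<omega> + b * \<xi> j \<omega>) ^ 4 \<partial>M) = 3 * (a\<^sup>2 + b\<^sup>2)\<^sup>2"
      using meso[of c N] var[of c N] by (simp_all add: mesokurtic_def)
  qed
  have fourth: "integrable M (\<lambda>\<omega>. \<xi> i \<omega> ^ 4)" "(\<integral>\<omega>. \<xi> i \<omega> ^ 4 \<partial>M) = 3" for i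
    using four[of i "Suc i" 1 0] by simp_all
  have sq: "integrable M (\<lambda>\<omega>. (\<xi> i \<omega>)\<^sup>2) \<and> (\<integral>\<omega>. (\<xi> i \<omega>)\<^sup>2 \<partial>M) = 1" for i
  proof -
    have "(\<Sum>k<Suc i. of_bool (k = i) * \<xi> k \<omega>) = \<xi> i \<omega>" for \<omega> by simp
    moreover have "(\<Sum>k<Suc i. (of_bool (k = i))\<^sup>2) = (1::real)"
      by simp
    ultimately show ?thesis
      using mesokurtic_integrable_power[OF meso[of "\<lambda>k. of_bool (k = i)" "Suc i"], of 2]
        var[of "\<lambda>k. of_bool (k = i)" "Suc i"] by simp
  qed
  have prod: "integrable M (\<lambda>\<omega>. (\<xi> i \<omega>)\<^sup>2 * (\<xi> j \<omega>)\<^sup>2) \<and>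
      (\<integral>\<omega>. (\<xi> i \<omega>)\<^sup>2 * (\<xi> j \<omega>)\<^sup>2 \<partial>M) = 1 + 2 * of_bool (i = j)" for i j
  proof (cases "i = j")
    case True
    then show ?thesis using fourth[of j] by (simp flip: power_add)
  next
    case False
    \<comment> \<open>Polarisation isolates the product of squares; its mean is then
      \<open>(12 + 12 - 6 - 6) / 12 = 1\<close>.\<close>
    have "(\<xi> i \<omega>)\<^sup>2 * (\<xi> j \<omega>)\<^sup>2 = ((1 * \<xi> i \<omega> + 1 * \<xi> j \<omega>) ^ 4 + (1 * \<xi> i \<omega> + (- 1) * \<xi> j \<omega>) ^ 4
        - 2 * \<xi> i \<omega> ^ 4 - 2 * \<xi> j \<omega> ^ 4) / 12" for \<omega>
      by (simp add: power2_eq_square power4_eq_xxxx algebra_simps)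
    note prod_eq = this
    show ?thesis
      unfolding prod_eq using four[OF False, of 1 1] four[OF False, of 1 "- 1"] fourth False by simp
  qed
  have S_sq: "(S N \<omega> - real N)\<^sup>2 = (\<Sum>i<N. \<Sum>j<N. (\<xi> i \<omega>)\<^sup>2 * (\<xi> j \<omega>)\<^sup>2)
      - 2 * real N * (\<Sum>i<N. (\<xi> i \<omega>)\<^sup>2) + (real N)\<^sup>2" for N \<omega>
    unfolding S_def power2_diff by (simp add: power2_eq_square sum_product)
  have S_int: "integrable M (\<lambda>\<omega>. (S N \<omega> - real N)\<^sup>2)" for N
    unfolding S_sq using prod sq by auto
  have S_var: "(\<integral>\<omega>. (S N \<omega> - real N)\<^sup>2 \<partial>M) = 2 * real N" for N
  proof -
    have "(\<integral>\<omega>. (S N \<omega> - real N)\<^sup>2 \<partial>M) = (\<Sum>i<N. \<Sum>j<N. 1 + 2 * of_bool (i = j)) - 2 * real N * real N + (real N)\<^sup>2"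
      unfolding S_sq using prod sq by (simp add: prob_space)
    also have "(\<Sum>i<N. \<Sum>j<N. 1 + 2 * of_bool (i = j)) = real N * real N + 2 * real N"
      by (simp add: sum.distrib distrib_left flip: sum_distrib_left)
    finally show ?thesis by (simp add: power2_eq_square)
  qed
  have "AE \<omega> in M. (\<lambda>k. ((S (k\<^sup>2) \<omega> - real (k\<^sup>2)) / real (k\<^sup>2))\<^sup>2) \<longlonglongrightarrow> 0"
  proof (rule AE_tendsto_0_if_summable_integral)
    fix k
    show "integrable M (\<lambda>\<omega>. ((S (k\<^sup>2) \<omega> - real (k\<^sup>2)) / real (k\<^sup>2))\<^sup>2)"
      using S_int[of "k\<^sup>2"] by (simp add: power_divide)
  next
    \<comment> \<open>Dividing \<open>2 N\<close> by \<open>N^2\<close> leaves \<open>2 / N\<close>: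
      summable along squares, not along all \<open>N\<close>.\<close>
    have "(\<integral>\<omega>. ((S (k\<^sup>2) \<omega> - real (k\<^sup>2)) / real (k\<^sup>2))\<^sup>2 \<partial>M) = 2 * inverse ((real k)\<^sup>2)" for k
    proof -
      have "(\<integral>\<omega>. ((S (k\<^sup>2) \<omega> - real (k\<^sup>2)) / real (k\<^sup>2))\<^sup>2 \<partial>M) = 2 * real (k\<^sup>2) / (real (k\<^sup>2))\<^sup>2"
        unfolding power_divide integral_divide_zero S_var ..
      then show ?thesis by (simp add: power2_eq_square field_simps)
    qed
    then show "summable (\<lambda>k. \<integral>\<omega>. ((S (k\<^sup>2) \<omega> - real (k\<^sup>2)) / real (k\<^sup>2))\<^sup>2 \<partial>M)"
      using summable_mult[OF inverse_power_summable[of 2, where 'a = real], of 2] by simp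
  qed simp
  then show ?thesis
  proof eventually_elim
    case (elim \<omega>)
    have "(\<lambda>k. (S (k\<^sup>2) \<omega> - real (k\<^sup>2)) / real (k\<^sup>2)) \<longlonglongrightarrow> 0"
      using tendsto_real_sqrt[OF elim] unfolding real_sqrt_abs real_sqrt_zero
      by (rule tendsto_rabs_zero_cancel)
    from tendsto_add[OF this tendsto_const[of 1]]
    have "(\<lambda>k. (S (k\<^sup>2) \<omega> - real (k\<^sup>2)) / real (k\<^sup>2) + 1) \<longlonglongrightarrow> 1" by simp
    moreover have "\<forall>\<^sub>F k in sequentially. (S (k\<^sup>2) \<omega> - real (k\<^sup>2)) / real (k\<^sup>2) + 1 = S (k\<^sup>2) \<omega> / real (k\<^sup>2)"
      using eventually_gt_at_top[of 0] by eventually_elim (simp add: field_simps)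
    ultimately have "(\<lambda>k. S (k\<^sup>2) \<omega> / real (k\<^sup>2)) \<longlonglongrightarrow> 1"
      by (rule Lim_transform_eventually)
    moreover have "mono (\<lambda>N. S N \<omega>)"
      unfolding S_def by (auto intro!: monoI sum_mono2)
    ultimately have "(\<lambda>N. S N \<omega> / real N) \<longlonglongrightarrow> 1"
      by (intro tendsto_average_if_along_squares) (auto simp: S_def intro: sum_nonneg)
    then show ?case by (simp add: S_def)
  qed
qed

text \<open>The square of a standardised variable has second moment 3, so after division by
  \<open>N\<close> the second moment is at most \<open>3 / N^2\<close>. This is summable over all
  \<open>N\<close>, and no subsequence is taken.\<close>

lemma (in prob_space) AE_projection_negligible:
  fixes \<xi> :: "nat \<Rightarrow> 'a \<Rightarrow> real"
  assumes meso: "\<And>N c. mesokurtic M (\<lambda>\<omega>. \<Sum>i<N. c i * \<xi> i \<omega>)"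
    and var: "\<And>(N::nat) c. (\<integral>\<omega>. (\<Sum>i<N. c i * \<xi> i \<omega>)\<^sup>2 \<partial>M) = (\<Sum>i<N. (c i)\<^sup>2)"
  shows "AE \<omega> in M. (\<lambda>N. (\<Sum>i<N. a i * \<xi> i \<omega>)\<^sup>2 / (\<Sum>i<N. (a i)\<^sup>2) / real N) \<longlonglongrightarrow> 0"
proof -
  define X where "X N \<omega> = (\<Sum>i<N. a i * \<xi> i \<omega>)" for N \<omega>
  define A where "A N = (\<Sum>i<N. (a i)\<^sup>2)" for N :: nat
  have X: "integrable M (\<lambda>\<omega>. X N \<omega> ^ 4)" "(\<integral>\<omega>. X N \<omega> ^ 4 \<partial>M) = 3 * (A N)\<^sup>2" for N
    using meso[of a N] var[of a N] by (simp_all add: mesokurtic_def X_def A_def)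
  have eq: "((X N \<omega>)\<^sup>2 / A N / real N)\<^sup>2 = X N \<omega> ^ 4 / ((A N)\<^sup>2 * (real N)\<^sup>2)" for N \<omega>
    by (simp add: power_divide power_mult_distrib flip: power_mult)
  have "AE \<omega> in M. (\<lambda>N. ((X N \<omega>)\<^sup>2 / A N / real N)\<^sup>2) \<longlonglongrightarrow> 0"
  proof (rule AE_tendsto_0_if_summable_integral)
    show "integrable M (\<lambda>\<omega>. ((X N \<omega>)\<^sup>2 / A N / real N)\<^sup>2)" for N
      unfolding eq using X(1) by simp
    \<comment> \<open>If \<open>A N = 0\<close>, division by zero makes the integral 0; otherwise
      the bound is attained.\<close>
    have "norm (\<integral>\<omega>. ((X N \<omega>)\<^sup>2 / A N / real N)\<^sup>2 \<partial>M) \<le> 3 * inverse ((real N)\<^sup>2)" for N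
      unfolding eq integral_divide_zero X(2) by (cases "A N = 0") (simp_all add: field_simps)
    then show "summable (\<lambda>N. \<integral>\<omega>. ((X N \<omega>)\<^sup>2 / A N / real N)\<^sup>2 \<partial>M)"
      by (intro summable_comparison_test[OF _ summable_mult[OF inverse_power_summable[of 2, where 'a = real], of 3]]) auto
  qed simp
  then show ?thesis
  proof eventually_elim
    case (elim \<omega>)
    show ?case
      using tendsto_real_sqrt[OF elim] unfolding real_sqrt_abs real_sqrt_zero X_def A_def
      by (rule tendsto_rabs_zero_cancel)
  qed
qed

section \<open>The estimator in orthonormal coordinates\<close>

lemma mat_inverse_eqI:
  fixes A B :: "'a :: field mat"
  assumes A: "A \<in> carrier_mat n n" and B: "B \<in> carrier_mat n n" and AB: "A * B = 1\<^sub>m n"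
  shows "mat_inverse A = Some B"
proof (cases "mat_inverse A")
  case None
  have "B * A = 1\<^sub>m n" by (rule mat_mult_left_right_inverse[OF A B AB])
  then have "A \<in> Units (ring_mat TYPE('a) n undefined)"
    using A B AB by (auto simp: Units_def ring_mat_def)
  with mat_inverse(1)[OF A None, of undefined] show ?thesis by blast
next
  case (Some C)
  from mat_inverse(2)[OF A this] have C: "C * A = 1\<^sub>m n" "C \<in> carrier_mat n n" by auto
  have "C = C * (A * B)" using AB C by simp
  also have "\<dots> = B" using A B C by (simp flip: assoc_mult_mat)
  finally show ?thesis using Some by simp
qed

text \<open>Let the coefficients of the \<open>P i\<close> be the rows of \<open>L\<close>.
  Orthonormality reads \<open>L * (C * L\<^sup>T) = 1\<^sub>m N\<close>, so the inverse of
  \<open>C\<close> is \<open>L\<^sup>T * L\<close> and its form is the inner product of the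
  transformed vectors.\<close>

lemma quadratic_form_inverse_eq_sum:
  fixes \<Gamma> :: "nat \<Rightarrow> nat \<Rightarrow> real" and P :: "nat \<Rightarrow> real poly"
  assumes deg: "\<And>n. degree (P n) \<le> n"
    and ortho: "\<And>n k. bil \<Gamma> (P n) (P k) = of_bool (n = k)"
  shows "vec N v \<bullet> (the (mat_inverse (mat N N (\<lambda>(i, j). \<Gamma> i j))) *\<^sub>v vec N w)
    = (\<Sum>i<N. lin_ext v (P i) * lin_ext w (P i))"
proof -
  define C where "C = mat N N (\<lambda>(i, j). \<Gamma> i j)"
  define L where "L = mat N N (\<lambda>(i, j). coeff (P i) j)"
  have car: "C \<in> carrier_mat N N" "L \<in> carrier_mat N N" "L\<^sup>T \<in> carrier_mat N N"
    by (simp_all add: C_def L_def)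
  \<comment> \<open>No coefficient of a row \<open>i < N\<close> is lost by cutting off at column
    \<open>N\<close>.\<close>
  have deg': "degree (P i) < N" if "i < N" for i
    using deg[of i] that by simp
  have "L * (C * L\<^sup>T) = 1\<^sub>m N"
  proof (rule eq_matI)
    fix i j assume ij: "i < dim_row (1\<^sub>m N)" "j < dim_col (1\<^sub>m N)"
    then have "(L * (C * L\<^sup>T)) $$ (i, j) = (\<Sum>k<N. \<Sum>l<N. coeff (P i) k * coeff (P j) l * \<Gamma> k l)"
      by (simp add: L_def C_def scalar_prod_def sum_distrib_left atLeast0LessThan mult_ac)
    also have "\<dots> = bil \<Gamma> (P i) (P j)"
      using ij by (simp add: bil_eq_sum[of _ N] deg')
    finally show "(L * (C * L\<^sup>T)) $$ (i, j) = 1\<^sub>m N $$ (i, j)"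
      using ij by (simp add: ortho)
  qed (simp_all add: L_def)
  \<comment> \<open>A one-sided inverse of a square matrix is two-sided, so \<open>L\<close> moves
    behind \<open>C * L\<^sup>T\<close>.\<close>
  from mat_mult_left_right_inverse[OF car(2) _ this] car
  have "C * (L\<^sup>T * L) = 1\<^sub>m N"
    by (simp flip: assoc_mult_mat)
  then have inv: "the (mat_inverse C) = L\<^sup>T * L"
    using mat_inverse_eqI[of C N "L\<^sup>T * L"] car by simp
  have L_vec: "L *\<^sub>v vec N u = vec N (\<lambda>i. lin_ext u (P i))" for u
    by (rule eq_vecI)
      (simp_all add: L_def scalar_prod_def atLeast0LessThan lin_ext_eq_sum[OF deg'])
  have "vec N v \<bullet> ((L\<^sup>T * L) *\<^sub>v vec N w) = (L\<^sup>T *\<^sub>v (L *\<^sub>v vec N w)) \<bullet> vec N v"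
    using car by (simp add: assoc_mult_mat_vec[of _ N N _ N] comm_scalar_prod[of _ N])
  also have "\<dots> = (L *\<^sub>v vec N w) \<bullet> (L *\<^sub>v vec N v)"
    using car by (intro transpose_vec_mult_scalar[of _ N N]) auto
  also have "\<dots> = (\<Sum>i<N. lin_ext v (P i) * lin_ext w (P i))"
    unfolding L_vec by (simp add: scalar_prod_def atLeast0LessThan mult.commute)
  finally show ?thesis by (simp add: inv flip: C_def)
qed

text \<open>A residual sum of squares after regression on \<open>a\<close> is unchanged by adding
  multiples of \<open>a\<close> and scales quadratically.\<close>

lemma residual_sum_of_squares_affine:
  fixes a \<xi> :: "nat \<Rightarrow> real"
  shows "(\<Sum>i<N. (\<theta> * a i + \<alpha> * \<xi> i)\<^sup>2) - (\<Sum>i<N. a i * (\<theta> * a i + \<alpha> * \<xi> i))\<^sup>2 / (\<Sum>i<N. (a i)\<^sup>2)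
    = \<alpha>\<^sup>2 * ((\<Sum>i<N. (\<xi> i)\<^sup>2) - (\<Sum>i<N. a i * \<xi> i)\<^sup>2 / (\<Sum>i<N. (a i)\<^sup>2))"
proof -
  define A X Q where "A = (\<Sum>i<N. (a i)\<^sup>2)" and "X = (\<Sum>i<N. a i * \<xi> i)" and "Q = (\<Sum>i<N. (\<xi> i)\<^sup>2)"
  have 1: "(\<Sum>i<N. (\<theta> * a i + \<alpha> * \<xi> i)\<^sup>2) = \<theta>\<^sup>2 * A + 2 * \<theta> * \<alpha> * X + \<alpha>\<^sup>2 * Q"
    by (simp add: A_def X_def Q_def power2_eq_square sum_distrib_left algebra_simps flip: sum.distrib)
  have 2: "(\<Sum>i<N. a i * (\<theta> * a i + \<alpha> * \<xi> i)) = \<theta> * A + \<alpha> * X"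
    by (simp add: A_def X_def power2_eq_square sum_distrib_left algebra_simps flip: sum.distrib)
  \<comment> \<open>With \<open>A = 0\<close> the quotients are zero by convention, so the cross
    term has to vanish as well.\<close>
  have "X = 0" if "A = 0"
    using that by (auto simp: A_def X_def sum_nonneg_eq_0_iff)
  then have "\<theta>\<^sup>2 * A + 2 * \<theta> * \<alpha> * X + \<alpha>\<^sup>2 * Q - (\<theta> * A + \<alpha> * X)\<^sup>2 / A = \<alpha>\<^sup>2 * (Q - X\<^sup>2 / A)"
    by (cases "A = 0") (simp_all add: field_simps power2_eq_square)
  then show ?thesis unfolding 1 2 by (simp add: A_def X_def Q_def)
qed

lemma alpha_sq_estimator_eq:
  fixes H :: "nat \<Rightarrow> real" and h :: real and m :: nat and y :: "real \<Rightarrow> real"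
  defines "\<Gamma> \<equiv> \<lambda>i j. \<Sum>r = 1..m. (grid_point h (Suc i) powr (2 * H r) + grid_point h (Suc j) powr (2 * H r)
      - \<bar>grid_point h (Suc i) - grid_point h (Suc j)\<bar> powr (2 * H r)) / 2"
  assumes deg: "\<And>n. degree (P n) \<le> n"
    and ortho: "\<And>n k. bil \<Gamma> (P n) (P k) = of_bool (n = k)"
  defines "a \<equiv> \<lambda>i. lin_ext (\<lambda>j. grid_point h (Suc j)) (P i)"
    and "\<xi> \<equiv> \<lambda>i. lin_ext (\<lambda>j. y (grid_point h (Suc j))) (P i)"
  shows "alpha_sq_estimator H m h (\<lambda>t. \<theta> * t + \<alpha> * y t) N
    = \<alpha>\<^sup>2 * ((\<Sum>i<N. (\<xi> i)\<^sup>2) / real N - (\<Sum>i<N. a i * \<xi> i)\<^sup>2 / (\<Sum>i<N. (a i)\<^sup>2) / real N)"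
proof -
  have cov: "cov_mat H m h N = mat N N (\<lambda>(i, j). \<Gamma> i j)"
    by (rule eq_matI) (simp_all add: cov_mat_def \<Gamma>_def sum_divide_distrib Let_def)
  have z: "lin_ext (\<lambda>j. \<theta> * grid_point h (Suc j) + \<alpha> * y (grid_point h (Suc j))) (P i) = \<theta> * a i + \<alpha> * \<xi> i" for i
    by (simp add: a_def \<xi>_def lin_ext_fun_add lin_ext_fun_cmult)
  have "alpha_sq_estimator H m h (\<lambda>t. \<theta> * t + \<alpha> * y t) N
      = ((\<Sum>i<N. (\<theta> * a i + \<alpha> * \<xi> i)\<^sup>2)
        - (\<Sum>i<N. a i * (\<theta> * a i + \<alpha> * \<xi> i))\<^sup>2 / (\<Sum>i<N. (a i)\<^sup>2)) / real N"
    unfolding alpha_sq_estimator_def Let_def cov time_vec_def obs_vec_def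
      quadratic_form_inverse_eq_sum[OF deg ortho]
    by (simp add: z power2_eq_square a_def)
  then show ?thesis
    unfolding residual_sum_of_squares_affine by (simp add: diff_divide_distrib right_diff_distrib)
qed

text \<open>On the grid the variance is a sum of powers with exponents strictly between 1 and 2. Its
  second differences therefore tend to zero, and the result on stationary increments
  applies.\<close>

lemma mixed_covariance_pos_def:
  fixes H :: "nat \<Rightarrow> real" and h :: real and I :: "nat set"
  defines "\<Gamma> \<equiv> \<lambda>i j. \<Sum>r\<in>I. (grid_point h (Suc i) powr (2 * H r) + grid_point h (Suc j) powr (2 * H r)
      - \<bar>grid_point h (Suc i) - grid_point h (Suc j)\<bar> powr (2 * H r)) / 2"
  assumes "h > 0" "finite I" "I \<noteq> {}" and H: "\<And>r. r \<in> I \<Longrightarrow> H r \<in> {1/2<..<1}"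
    and psd: "\<And>p. bil \<Gamma> p p \<ge> 0" and "p \<noteq> 0"
  shows "bil \<Gamma> p p > 0"
proof -
  \<comment> \<open>The absolute value extends the variance evenly to negative indices.\<close>
  define f where "f k = (\<Sum>r\<in>I. \<bar>real_of_int k * h\<bar> powr (2 * H r))" for k
  have abs_h: "\<bar>x * h\<bar> powr b = h powr b * \<bar>x\<bar> powr b" for x b
    using \<open>h > 0\<close> by (simp add: abs_mult powr_mult mult.commute)
  have \<Gamma>: "\<Gamma> = (\<lambda>i j. (f (int (Suc i)) + f (int (Suc j)) - f (int i - int j)) / 2)"
  proof (intro ext)
    fix i j
    have "grid_point h (Suc i) - grid_point h (Suc j) = real_of_int (int i - int j) * h"
      by (simp add: grid_point_def algebra_simps)
    moreover have "grid_point h (Suc k) = \<bar>real_of_int (int (Suc k)) * h\<bar>" for k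
      using \<open>h > 0\<close> by (simp add: grid_point_def)
    ultimately show "\<Gamma> i j = (f (int (Suc i)) + f (int (Suc j)) - f (int i - int j)) / 2"
      unfolding \<Gamma>_def f_def by (simp only: sum.distrib sum_subtractf flip: sum_divide_distrib)
  qed
  have "f 1 > 0"
    unfolding f_def using assms by (intro sum_pos) auto
  have "(\<lambda>n. \<Sum>r\<in>I. h powr (2 * H r) * ((real n + 1) powr (2 * H r) + \<bar>real n - 1\<bar> powr (2 * H r)
      - 2 * real n powr (2 * H r))) \<longlonglongrightarrow> 0"
    using H by (intro tendsto_null_sum tendsto_mult_right_zero second_difference_powr_tendsto_0)
      (fastforce simp: mult.commute)+
  also have "(\<lambda>n. \<Sum>r\<in>I. h powr (2 * H r) * ((real n + 1) powr (2 * H r) + \<bar>real n - 1\<bar> powr (2 * H r)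
      - 2 * real n powr (2 * H r))) = (\<lambda>n. f (int n + 1) + f (int n - 1) - 2 * f (int n))"
    unfolding f_def abs_h
    by (simp add: sum_distrib_left algebra_simps flip: sum.distrib sum_subtractf)
  finally show ?thesis
    using \<open>f 1 > 0\<close> \<open>p \<noteq> 0\<close> psd unfolding \<Gamma>
    by (intro stationary_increments_pos_def) (auto simp: f_def)
qed

section \<open>Assembly of the almost sure limit\<close>

theorem theorem4p7:
  fixes M :: "'w measure" and B :: "nat \<Rightarrow> real \<Rightarrow> 'w \<Rightarrow> real"
    and H :: "nat \<Rightarrow> real" and m :: nat and h \<theta> \<alpha> :: real
  assumes "prob_space M"
    and "h > 0"
    and "m \<ge> 1"
    and "\<And>r. r \<in> {1..m} \<Longrightarrow> H r \<in> {1/2<..<1}"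
    and "\<And>r. r \<in> {1..m} \<Longrightarrow> fractional_Brownian_motion M (H r) (B r)"
    and "independent_processes M B {1..m}"
    and "\<alpha> > 0"
  shows "AE \<omega> in M.
    (\<lambda>N. alpha_sq_estimator H m h (\<lambda>t. mixed_fbm_with_drift \<theta> \<alpha> m B t \<omega>) N) \<longlonglongrightarrow> \<alpha>\<^sup>2"
proof -
  interpret prob_space M by fact
  \<comment> \<open>Index \<open>i\<close> stands for grid time \<open>i + 1\<close>; time 0, where
    the variance is zero, is left out.\<close>
  define g where "g i = grid_point h (Suc i)" for i
  define Y where "Y i \<omega> = (\<Sum>r = 1..m. B r (g i) \<omega>)" for i \<omega>
  define \<Gamma> where "\<Gamma> i j = (\<Sum>r = 1..m. (g i powr (2 * H r) + g j powr (2 * H r)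
      - \<bar>g i - g j\<bar> powr (2 * H r)) / 2)" for i j
  have g: "inj g" "g i \<ge> 0" for i
    using \<open>h > 0\<close> by (auto simp: g_def grid_point_def inj_on_def)
  have Y: "mesokurtic M (\<lambda>\<omega>. lin_ext (\<lambda>i. Y i \<omega>) p)"
      "(\<integral>\<omega>. (lin_ext (\<lambda>i. Y i \<omega>) p)\<^sup>2 \<partial>M) = bil \<Gamma> p p" for p
    using mixed_fractional_Brownian_motion_lin_ext[OF assms(5,6) _ g, of p]
    unfolding Y_def \<Gamma>_def[abs_def] by auto
  \<comment> \<open>Semidefiniteness is free, because the form is a second moment.\<close>
  have "bil \<Gamma> p p \<ge> 0" for p
    unfolding Y(2)[symmetric] by (rule Bochner_Integration.integral_nonneg) simp
  then have pd: "bil \<Gamma> p p > 0" if "p \<noteq> 0" for p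
    using mixed_covariance_pos_def[of h "{1..m}" H p] assms(2-4) that
    unfolding \<Gamma>_def[abs_def] g_def by auto
  have "\<Gamma> i j = \<Gamma> j i" for i j
    by (simp add: \<Gamma>_def add.commute abs_minus_commute)
  from orthonormal_sequence_exists[OF this pd]
  obtain P where deg: "\<And>n. degree (P n) \<le> n"
    and ortho: "\<And>n k. bil \<Gamma> (P n) (P k) = of_bool (n = k)" by blast
  define a where "a i = lin_ext g (P i)" for i
  define \<xi> where "\<xi> i \<omega> = lin_ext (\<lambda>i. Y i \<omega>) (P i)" for i \<omega>
  \<comment> \<open>Combinations of the \<open>\<xi> i\<close> are again functionals of
    \<open>Y\<close>, so the moment identities carry over, and orthonormality turns the form into a
    sum of squares.\<close>
  have lin: "(\<Sum>i<N. c i * \<xi> i \<omega>) = lin_ext (\<lambda>i. Y i \<omega>) (\<Sum>i<N. smult (c i) (P i))" for N c \<omega>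
    by (simp add: \<xi>_def lin_ext_sum lin_ext_smult)
  have meso: "mesokurtic M (\<lambda>\<omega>. \<Sum>i<N. c i * \<xi> i \<omega>)" for N c
    unfolding lin by (rule Y)
  have var: "(\<integral>\<omega>. (\<Sum>i<N. c i * \<xi> i \<omega>)\<^sup>2 \<partial>M) = (\<Sum>i<N. (c i)\<^sup>2)" for N c
    unfolding lin Y by (simp add: bil_simps ortho power2_eq_square of_bool_def if_distrib cong: if_cong)
  have est: "alpha_sq_estimator H m h (\<lambda>t. mixed_fbm_with_drift \<theta> \<alpha> m B t \<omega>) N
      = \<alpha>\<^sup>2 * ((\<Sum>i<N. (\<xi> i \<omega>)\<^sup>2) / real N - (\<Sum>i<N. a i * \<xi> i \<omega>)\<^sup>2 / (\<Sum>i<N. (a i)\<^sup>2) / real N)" for \<omega> N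
    unfolding mixed_fbm_with_drift_def a_def \<xi>_def Y_def g_def[abs_def]
    by (rule alpha_sq_estimator_eq[OF deg]) (use ortho in \<open>simp add: \<Gamma>_def[abs_def] g_def\<close>)
  from AE_mean_squares_tendsto_1[of \<xi>, OF meso var] AE_projection_negligible[of \<xi> a, OF meso var]
  show ?thesis
  proof eventually_elim
    case (elim \<omega>)
    show ?case
      unfolding est using tendsto_mult[OF tendsto_const[of "\<alpha>\<^sup>2"] tendsto_diff[OF elim]] by simp
  qed
qed

end
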